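(* Let $(\Omega,\Sigma,P)$ be a probability space, let $\{W_n\}_{n\in\mathbb{N}}$ be the interarrival process of a counting process $\{N_t\}_{t\in\mathbb{R}_+}$ on it, let $\mathcal{F}$ be a $\sigma$-subalgebra of $\Sigma$, let $R:=P\mid\mathcal{F}$, let $\{P_\omega\}_{\omega\in\Omega}$ be a subfield regular conditional probability for $P$ over $R$, and let $\omega\mapsto\mathbf{K}(\omega)$ be a Markov kernel from $(\Omega,\mathcal{F})$ to $(\mathbb{R},\mathfrak{B}(\mathbb{R}))$; write $\mathbf{K}(\mathrm{id}_\Omega)(B,\omega):=\mathbf{K}(\omega)(B)$. Then $\{W_n\}_{n\in\mathbb{N}}$ is $P$-conditionally i.i.d. over $\mathcal{F}$ with $\mathbf{K}(\mathrm{id}_\Omega)=P_{W_n\mid\mathcal{F}}$ $P\mid\mathcal{F}$-a.s. for each $n\in\mathbb{N}$ if and only if for $R$-almost all $\omega\in\Omega$ the sequence $\{W_n\}_{n\in\mathbb{N}}$ is $P_\omega$-independent and $(P_\omega)_{W_n}=\mathbf{K}(\omega)$ holds for each $n\in\mathbb{N}$.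
   Context: Counting process: a family $\{N_t\}_{t\in\mathbb{R}_+}$ of $\Sigma$-measurable maps such that every path takes values in $\mathbb{N}_0\cup\{\infty\}$, vanishes at $t=0$, is nondecreasing and right-continuous, has jumps of size at most one ($N_t\le\sup_{s<t}N_s+1$ for $t>0$) and increases to infinity ($\sup_tN_t=\infty$). Interarrival process: $W_n:=T_n-T_{n-1}$ where $T_n:=\inf\{t\in\mathbb{R}_+:N_t=n\}$. Subfield regular conditional probability for $P$ over $R=P\mid\mathcal{F}$: a family $\{P_\omega\}_{\omega\in\Omega}$ of probability measures on $\Sigma$ such that $\omega\mapsto P_\omega(E)$ is $\mathcal{F}$-measurable for each $E\in\Sigma$, and $\int_FP_\omega(E)\,R(d\omega)=P(E\cap F)$ for all $F\in\mathcal{F}$, $E\in\Sigma$. A family $\{X_i\}_{i\in I}$ of measurable maps is $P$-conditionally independent over $\mathcal{F}$ if for each $n\ge2$, distinct $i_1,\dots,i_n\in I$ and $E_j\in\sigma(X_{i_j})$, $P(E_1\cap\dots\cap E_n\mid\mathcal{F})=\prod_jP(E_j\mid\mathcal{F})$ a.s.; it is $P$-conditionally identically distributed over $\mathcal{F}$ if $P(F\cap X_i^{-1}(B))=P(F\cap X_j^{-1}(B))$ for all $i,j\in I$, $F\in\mathcal{F}$ and measurable $B$; conditionally i.i.d. means both. $P_{X\mid\mathcal{F}}$ is a Markov kernel, $\mathcal{F}$-measurable in $\omega$, with $P_{X\mid\mathcal{F}}(B,\cdot)=P(X^{-1}(B)\mid\mathcal{F})$ a.s. for each measurable $B$. Two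 such kernels are equal $P\mid\mathcal{F}$-a.s. if there is a $P$-null set in $\mathcal{F}$ outside of which they agree for all $B$. $(P_\omega)_{W_n}:=P_\omega\circ W_n^{-1}$ on $\mathfrak{B}(\mathbb{R})$. *)

theory Defs
  imports "HOL-Probability.Probability"
begin

text \<open>
  A path is indexed by all of \<^typ>\<open>real\<close>, but only its values at times \<open>t \<ge> 0\<close> are ever used.
  The type \<^typ>\<open>enat\<close> plays the role of $\mathbb{N}_0 \cup \{\infty\}$; its order topology is
  the one inherited from the extended reals, and its Borel sets are all subsets.
\<close>

definition counting_process :: "'a measure \<Rightarrow> (real \<Rightarrow> 'a \<Rightarrow> enat) \<Rightarrow> bool" where
  "counting_process M N \<longleftrightarrow>
     (\<forall>t\<ge>0. N t \<in> M \<rightarrow>\<^sub>M count_space UNIV) \<and>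
     (\<forall>\<omega>\<in>space M.
        N 0 \<omega> = 0 \<and>
        mono_on {0..} (\<lambda>t. N t \<omega>) \<and>
        (\<forall>t\<ge>0. continuous (at_right t) (\<lambda>s. N s \<omega>)) \<and>
        (\<forall>t>0. N t \<omega> \<le> (SUP s\<in>{0..<t}. N s \<omega>) + 1) \<and>
        (SUP t\<in>{0..}. N t \<omega>) = \<infinity>)"

text \<open>
  On the paths of a counting process every level \<open>n\<close> is attained, so the infimum below
  is taken over a nonempty set that is bounded below.
\<close>

definition arrival_time :: "(real \<Rightarrow> 'a \<Rightarrow> enat) \<Rightarrow> nat \<Rightarrow> 'a \<Rightarrow> real" where
  "arrival_time N n \<omega> = Inf {t. 0 \<le> t \<and> N t \<omega> = enat n}"

text \<open>Meaningful for \<open>n \<ge> 1\<close> only; families of interarrival times are indexed by \<open>{1..}\<close>.\<close>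

definition interarrival :: "(real \<Rightarrow> 'a \<Rightarrow> enat) \<Rightarrow> nat \<Rightarrow> 'a \<Rightarrow> real" where
  "interarrival N n \<omega> = arrival_time N n \<omega> - arrival_time N (n - 1) \<omega>"

text \<open>
  Sub-$\sigma$-algebras are given by measures \<open>F\<close> with \<^term>\<open>subalgebra M F\<close>; only the $\sigma$-algebra
  of \<open>F\<close> matters, and the restriction of \<open>M\<close> to it is \<^term>\<open>restr_to_subalg M F\<close>.
  Membership in \<open>F \<rightarrow>\<^sub>M prob_algebra M\<close> says that every \<open>Q \<omega>\<close> is a probability measure on the
  $\sigma$-algebra of \<open>M\<close> and that \<open>\<omega> \<mapsto> Q \<omega> E\<close> is \<open>F\<close>-measurable for every measurable \<open>E\<close>.
\<close>

definition subfield_rcp :: "'a measure \<Rightarrow> 'a measure \<Rightarrow> ('a \<Rightarrow> 'a measure) \<Rightarrow> bool" where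
  "subfield_rcp M F Q \<longleftrightarrow>
     Q \<in> F \<rightarrow>\<^sub>M prob_algebra M \<and>
     (\<forall>A\<in>sets F. \<forall>E\<in>sets M.
        (\<integral>\<^sup>+\<omega>\<in>A. emeasure (Q \<omega>) E \<partial>restr_to_subalg M F) = emeasure M (E \<inter> A))"

definition cond_probability :: "'a measure \<Rightarrow> 'a measure \<Rightarrow> 'a set \<Rightarrow> 'a \<Rightarrow> real" where
  "cond_probability M F E = real_cond_exp M F (indicator E)"

definition cond_indep_vars ::
  "'a measure \<Rightarrow> 'a measure \<Rightarrow> 'b measure \<Rightarrow> ('i \<Rightarrow> 'a \<Rightarrow> 'b) \<Rightarrow> 'i set \<Rightarrow> bool" where
  "cond_indep_vars M F S X I \<longleftrightarrow>
     (\<forall>i\<in>I. X i \<in> M \<rightarrow>\<^sub>M S) \<and>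
     (\<forall>J\<subseteq>I. finite J \<longrightarrow> 2 \<le> card J \<longrightarrow>
        (\<forall>E. (\<forall>j\<in>J. E j \<in> sets (vimage_algebra (space M) (X j) S)) \<longrightarrow>
           (AE \<omega> in restr_to_subalg M F.
              cond_probability M F (\<Inter>j\<in>J. E j) \<omega> = (\<Prod>j\<in>J. cond_probability M F (E j) \<omega>))))"

definition cond_ident_distr ::
  "'a measure \<Rightarrow> 'a measure \<Rightarrow> 'b measure \<Rightarrow> ('i \<Rightarrow> 'a \<Rightarrow> 'b) \<Rightarrow> 'i set \<Rightarrow> bool" where
  "cond_ident_distr M F S X I \<longleftrightarrow>
     (\<forall>i\<in>I. X i \<in> M \<rightarrow>\<^sub>M S) \<and>
     (\<forall>i\<in>I. \<forall>j\<in>I. \<forall>A\<in>sets F. \<forall>B\<in>sets S.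
        emeasure M (A \<inter> (X i -` B)) = emeasure M (A \<inter> (X j -` B)))"

definition cond_iid ::
  "'a measure \<Rightarrow> 'a measure \<Rightarrow> 'b measure \<Rightarrow> ('i \<Rightarrow> 'a \<Rightarrow> 'b) \<Rightarrow> 'i set \<Rightarrow> bool" where
  "cond_iid M F S X I \<longleftrightarrow> cond_indep_vars M F S X I \<and> cond_ident_distr M F S X I"

definition is_cond_distribution ::
  "'a measure \<Rightarrow> 'a measure \<Rightarrow> 'b measure \<Rightarrow> ('a \<Rightarrow> 'b) \<Rightarrow> ('a \<Rightarrow> 'b measure) \<Rightarrow> bool" where
  "is_cond_distribution M F S X \<kappa> \<longleftrightarrow>
     \<kappa> \<in> F \<rightarrow>\<^sub>M prob_algebra S \<and>
     (\<forall>B\<in>sets S. AE \<omega> in restr_to_subalg M F.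
        measure (\<kappa> \<omega>) B = cond_probability M F (X -` B \<inter> space M) \<omega>)"

text \<open>
  A chosen version of the conditional distribution of \<open>X\<close> over \<open>F\<close>. For real-valued \<open>X\<close> versions
  exist and any two of them agree almost surely. With a subfield regular conditional probability \<open>Q\<close>
  at hand, \<open>\<omega> \<mapsto> distr (Q \<omega>) S X\<close> is a version.
\<close>

definition cond_distribution ::
  "'a measure \<Rightarrow> 'a measure \<Rightarrow> 'b measure \<Rightarrow> ('a \<Rightarrow> 'b) \<Rightarrow> 'a \<Rightarrow> 'b measure" where
  "cond_distribution M F S X = (SOME \<kappa>. is_cond_distribution M F S X \<kappa>)"

end

theory Submission
  imports Defs
begin

text \<open>
  For every measurable \<open>E\<close> the random variable \<open>\<omega> \<mapsto> Q \<omega> E\<close> is a version of the conditional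
  probability of \<open>E\<close>. Both sides of the equivalence are therefore families of identities between
  values of \<open>Q \<omega>\<close>; they differ only in the order of the quantifiers over the events and over
  \<open>\<omega>\<close>. The quantifiers can be interchanged because independence and equality of
  distributions need to be tested only on a countable, intersection stable generator of the Borel sets
  and on the countably many finite sets of indices.
\<close>

section \<open>Countable generators and what they determine\<close>

text \<open>Finite intersections of members of a countable basis are open, still countably many, and
  closed under intersection; the empty family contributes \<open>UNIV\<close>. A property that holds
  almost surely for each generator set then holds almost surely for all of them at once.\<close>

lemma borel_countable_Int_stable_generator:
  obtains G :: "'b::second_countable_topology set set"
  where "countable G" "Int_stable G" "UNIV \<in> G" "sets borel = sigma_sets UNIV G"
proof -
  obtain B :: "'b set set" where B: "countable B" "topological_basis B"
    using ex_countable_basis by blast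
  define G where "G = Inter ` {A. finite A \<and> A \<subseteq> B}"
  have "countable G"
    unfolding G_def using B(1) by (intro countable_image countable_Collect_finite_subset)
  moreover have "Int_stable G"
  proof (rule Int_stableI)
    fix U V assume "U \<in> G" "V \<in> G"
    then obtain A C where "U = \<Inter>A" "V = \<Inter>C" "finite A" "A \<subseteq> B" "finite C" "C \<subseteq> B"
      by (auto simp: G_def)
    then show "U \<inter> V \<in> G"
      unfolding G_def by (intro image_eqI[of _ _ "A \<union> C"]) auto
  qed
  moreover have "UNIV \<in> G"
    unfolding G_def by (intro image_eqI[of _ _ "{}"]) auto
  moreover have "sets borel = sigma_sets UNIV G"
  proof (rule antisym)
    have "B \<subseteq> G"
    proof
      fix U assume "U \<in> B"
      then show "U \<in> G"
        unfolding G_def by (intro image_eqI[of _ _ "{U}"]) auto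
    qed
    moreover have "sets borel = sigma_sets UNIV B"
      by (subst borel_eq_countable_basis[OF B]) simp
    ultimately show "sets borel \<subseteq> sigma_sets UNIV G"
      by (simp add: sigma_sets_mono')
    have "open U" if "U \<in> G" for U
      using that B(2) by (auto simp: G_def topological_basis_open subset_iff intro!: open_Inter)
    then show "sigma_sets UNIV G \<subseteq> sets borel"
      by (intro sets.sigma_sets_subset'[of _ borel, simplified]) auto
  qed
  ultimately show thesis
    by (rule that)
qed

text \<open>Countability of \<open>G\<close> merges the null sets of the single identities into one.
  Outside of it the two measures agree on an intersection stable generator, hence everywhere by
  Dynkin's uniqueness theorem.\<close>

lemma AE_prob_measures_eqI:
  assumes G: "countable G" "Int_stable G" "\<Omega> \<in> G" "G \<subseteq> Pow \<Omega>"
    and \<mu>: "\<And>x. x \<in> space R \<Longrightarrow> prob_space (\<mu> x)" "\<And>x. x \<in> space R \<Longrightarrow> sets (\<mu> x) = sigma_sets \<Omega> G"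
    and \<nu>: "\<And>x. x \<in> space R \<Longrightarrow> prob_space (\<nu> x)" "\<And>x. x \<in> space R \<Longrightarrow> sets (\<nu> x) = sigma_sets \<Omega> G"
    and eq: "\<And>B. B \<in> G \<Longrightarrow> AE x in R. measure (\<mu> x) B = measure (\<nu> x) B"
  shows "AE x in R. \<mu> x = \<nu> x"
proof -
  have "AE x in R. \<forall>B\<in>G. measure (\<mu> x) B = measure (\<nu> x) B"
    using eq G(1) by (simp add: AE_ball_countable)
  then show ?thesis
    using AE_space
  proof eventually_elim
    case (elim x)
    interpret \<mu>: prob_space "\<mu> x" using \<mu> elim by blast
    interpret \<nu>: prob_space "\<nu> x" using \<nu> elim by blast
    \<comment> \<open>The one-element cover \<open>{\<Omega>}\<close> suffices as exhausting family,
      since \<open>\<Omega>\<close> lies in \<open>G\<close> and has mass 1.\<close>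
    show ?case
      by (rule measure_eqI_generator_eq_countable[where E = G and \<Omega> = \<Omega> and A = "{\<Omega>}"])
        (use G \<mu> \<nu> elim in \<open>auto simp: \<mu>.emeasure_eq_measure \<nu>.emeasure_eq_measure\<close>)
  qed
qed

text \<open>Preimages of an intersection stable generator form an intersection stable generator of
  the sigma-algebra of \<open>X i\<close>, and independence extends from the former to the latter.
  The product rule is asked only for two or more indices, as in \<open>cond_indep_vars\<close>, and
  for extensional families \<open>A\<close>, so that countably many tests result when
  \<open>I\<close> and \<open>G\<close> are countable.\<close>

lemma (in prob_space) indep_vars_generatorI:
  assumes X: "\<And>i. i \<in> I \<Longrightarrow> X i \<in> M \<rightarrow>\<^sub>M S"
    and G: "Int_stable G" "G \<subseteq> Pow (space S)" "sets S = sigma_sets (space S) G"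
    and prod: "\<And>J A. J \<subseteq> I \<Longrightarrow> finite J \<Longrightarrow> 2 \<le> card J \<Longrightarrow> A \<in> J \<rightarrow>\<^sub>E G \<Longrightarrow>
      prob (\<Inter>j\<in>J. X j -` A j \<inter> space M) = (\<Prod>j\<in>J. prob (X j -` A j \<inter> space M))"
  shows "indep_vars (\<lambda>_. S) X I"
proof -
  let ?E = "\<lambda>i. {X i -` A \<inter> space M |A. A \<in> G}"
  have "indep_sets ?E I"
  proof (rule indep_setsI)
    show "?E i \<subseteq> events" if "i \<in> I" for i
      using X[OF that] G(3) by (auto intro!: measurable_sets)
  next
    fix E J assume J: "J \<noteq> {}" "J \<subseteq> I" "finite J" and "\<forall>j\<in>J. E j \<in> ?E j"
    then have "\<forall>j\<in>J. \<exists>A\<in>G. E j = X j -` A \<inter> space M"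
      by blast
    then obtain A where A: "\<And>j. j \<in> J \<Longrightarrow> A j \<in> G" "\<And>j. j \<in> J \<Longrightarrow> E j = X j -` A j \<inter> space M"
      by metis
    show "prob (\<Inter>j\<in>J. E j) = (\<Prod>j\<in>J. prob (E j))"
    proof (cases "2 \<le> card J")
      case True
      \<comment> \<open>The chosen \<open>A\<close> is arbitrary outside \<open>J\<close>; cutting
        it down with \<open>restrict\<close> makes it extensional and changes none of the
        events.\<close>
      then show ?thesis
        using prod[of J "restrict A J"] J A by (simp cong: INF_cong)
    next
      case False
      moreover have "card J \<noteq> 0" using J by simp
      ultimately have "card J = 1" by linarith
      then show ?thesis by (auto simp: card_1_singleton_iff)
    qed
  qed
  moreover have "Int_stable (?E i)" for i
  proof (rule Int_stableI)
    fix U V assume "U \<in> ?E i" "V \<in> ?E i"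
    then obtain A B where "A \<in> G" "B \<in> G" "U = X i -` A \<inter> space M" "V = X i -` B \<inter> space M"
      by blast
    then show "U \<inter> V \<in> ?E i"
      using G(1) by (intro CollectI exI[of _ "A \<inter> B"]) (auto simp: Int_stable_def)
  qed
  ultimately have "indep_sets (\<lambda>i. sigma_sets (space M) (?E i)) I"
    by (rule indep_sets_sigma)
  \<comment> \<open>Taking preimages commutes with generating a sigma-algebra, so the result is the
    full sigma-algebra of \<open>X i\<close>.\<close>
  moreover have "sigma_sets (space M) (?E i) = {X i -` A \<inter> space M |A. A \<in> sets S}" if "i \<in> I" for i
    using sigma_sets_vimage_commute[of "X i" "space M" "space S" G] measurable_space[OF X[OF that]] G(3)
    by auto
  ultimately show ?thesis
    using X by (simp add: indep_vars_def2 cong: indep_sets_cong)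
qed

section \<open>Regular conditional probabilities as versions of conditional probabilities and
  distributions\<close>

locale subfield_rcp_space = prob_space M for M :: "'a measure" +
  fixes F :: "'a measure" and Q :: "'a \<Rightarrow> 'a measure"
  assumes subalgebra: "subalgebra M F" and rcp: "subfield_rcp M F Q"
begin

sublocale finite_measure_subalgebra M F
  by unfold_locales (rule subalgebra)

lemma measurable_rcp: "Q \<in> F \<rightarrow>\<^sub>M prob_algebra M"
  using rcp by (simp add: subfield_rcp_def)

lemma space_subalg: "space F = space M"
  using subalgebra by (simp add: subalgebra_def)

lemma
  assumes "\<omega> \<in> space M"
  shows prob_space_rcp: "prob_space (Q \<omega>)" and sets_rcp: "sets (Q \<omega>) = sets M"
    and space_rcp: "space (Q \<omega>) = space M"
proof -
  show "prob_space (Q \<omega>)" "sets (Q \<omega>) = sets M"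
    using measurable_space[OF measurable_rcp, of \<omega>] assms
    by (auto simp: space_prob_algebra space_subalg)
  from this(2) show "space (Q \<omega>) = space M"
    by (rule sets_eq_imp_space_eq)
qed

lemma measurable_rcp_iff: "\<omega> \<in> space M \<Longrightarrow> f \<in> Q \<omega> \<rightarrow>\<^sub>M S \<longleftrightarrow> f \<in> M \<rightarrow>\<^sub>M S"
  using measurable_cong_sets[OF sets_rcp refl] by blast

lemma measurable_measure_rcp:
  "E \<in> sets M \<Longrightarrow> (\<lambda>\<omega>. measure (Q \<omega>) E) \<in> borel_measurable F"
  using measurable_compose[OF measurable_prob_algebraD[OF measurable_rcp]
      measurable_measure_subprob_algebra] .

lemma emeasure_Int_eq_rcp:
  assumes "A \<in> sets F" "E \<in> sets M"
  shows "emeasure M (E \<inter> A) = (\<integral>\<^sup>+\<omega>\<in>A. emeasure (Q \<omega>) E \<partial>restr_to_subalg M F)"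
  using assms rcp by (simp add: subfield_rcp_def)

text \<open>The integral identity in \<open>subfield_rcp\<close>, tested on all sets of
  \<open>F\<close>, is the characterization of the conditional expectation of
  \<open>indicator E\<close>. What has to be done is to pass from nonnegative integrals over the
  restriction to real integrals over \<open>M\<close>.\<close>

lemma cond_probability_eq_rcp:
  assumes E: "E \<in> sets M"
  shows "AE \<omega> in restr_to_subalg M F. cond_probability M F E \<omega> = measure (Q \<omega>) E"
proof (rule AE_restr_to_subalg2[OF subalgebra])
  have [measurable]: "(\<lambda>\<omega>. measure (Q \<omega>) E) \<in> borel_measurable F"
    by (rule measurable_measure_rcp[OF E])
  then have [measurable]: "(\<lambda>\<omega>. measure (Q \<omega>) E) \<in> borel_measurable M"
    by (rule measurable_from_subalg[OF subalgebra])
  have bound: "AE \<omega> in M. norm (measure (Q \<omega>) E) \<le> 1"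
    by (rule AE_I2) (simp add: prob_space.prob_le_1[OF prob_space_rcp])
  have int: "integrable M (\<lambda>\<omega>. measure (Q \<omega>) E)"
    by (rule integrable_const_bound[OF bound]) measurable
  \<comment> \<open>Both sides are \<open>F\<close>-measurable, so the set where they differ lies in
    \<open>F\<close>; being null for \<open>M\<close> it is null for the restriction as
    well.\<close>
  show "Measurable.pred F (\<lambda>\<omega>. cond_probability M F E \<omega> = measure (Q \<omega>) E)"
    unfolding cond_probability_def by measurable
  show "AE \<omega> in M. cond_probability M F E \<omega> = measure (Q \<omega>) E"
    unfolding cond_probability_def
  proof (rule real_cond_exp_charact)
    fix A assume A: "A \<in> sets F"
    then have A': "A \<in> sets M"
      using subalgebra by (auto simp: subalgebra_def)
    have [measurable]: "A \<in> sets F" "A \<in> sets M" "E \<in> sets M" by fact+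
    \<comment> \<open>The integrand is nonnegative and bounded, so its real integral is a
      nonnegative integral; being \<open>F\<close>-measurable, it has the same integral over the
      restriction, where \<open>emeasure_Int_eq_rcp\<close> applies.\<close>
    have "ennreal (\<integral>\<omega>\<in>A. measure (Q \<omega>) E \<partial>M) = (\<integral>\<^sup>+\<omega>. ennreal (indicator A \<omega> * measure (Q \<omega>) E) \<partial>M)"
      unfolding set_lebesgue_integral_def using integrable_mult_indicator[OF A' int]
      by (subst nn_integral_eq_integral) auto
    also have "\<dots> = (\<integral>\<^sup>+\<omega>. ennreal (indicator A \<omega> * measure (Q \<omega>) E) \<partial>restr_to_subalg M F)"
      by (rule nn_integral_subalgebra2[OF subalgebra, symmetric]) measurable
    also have "\<dots> = (\<integral>\<^sup>+\<omega>\<in>A. emeasure (Q \<omega>) E \<partial>restr_to_subalg M F)"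
      by (intro nn_integral_cong)
        (auto simp: space_restr_to_subalg indicator_def
          finite_measure.emeasure_eq_measure[OF prob_space.finite_measure[OF prob_space_rcp]])
    also have "\<dots> = ennreal (measure M (E \<inter> A))"
      using emeasure_Int_eq_rcp[OF A E] by (simp add: emeasure_eq_measure)
    finally have "(\<integral>\<omega>\<in>A. measure (Q \<omega>) E \<partial>M) = measure M (E \<inter> A)"
      by (subst (asm) ennreal_inj)
        (auto simp: set_lebesgue_integral_def intro!: integral_nonneg_AE)
    moreover have "(\<integral>\<omega>\<in>A. indicator E \<omega> \<partial>M) = measure M (E \<inter> A)"
      by (simp add: set_lebesgue_integral_def indicator_inter_arith[symmetric] Int_commute)
    ultimately show "(\<integral>\<omega>\<in>A. indicator E \<omega> \<partial>M) = (\<integral>\<omega>\<in>A. measure (Q \<omega>) E \<partial>M)"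
      by simp
  qed (use int E in \<open>auto simp: emeasure_eq_measure\<close>)
qed

text \<open>The mass that the image measure gives to \<open>B\<close> is the
  \<open>Q \<omega>\<close>-mass of the preimage of \<open>B\<close>, a version of its conditional
  probability. This also proves that conditional distributions exist here.\<close>

lemma is_cond_distribution_distr_rcp:
  assumes X[measurable]: "X \<in> M \<rightarrow>\<^sub>M S"
  shows "is_cond_distribution M F S X (\<lambda>\<omega>. distr (Q \<omega>) S X)"
  unfolding is_cond_distribution_def
proof (intro conjI ballI)
  show "(\<lambda>\<omega>. distr (Q \<omega>) S X) \<in> F \<rightarrow>\<^sub>M prob_algebra S"
    using measurable_compose[OF measurable_prob_algebraD[OF measurable_rcp] measurable_distr[OF X]]
    by (intro measurable_prob_algebraI)
      (auto simp: space_subalg measurable_rcp_iff X intro!: prob_space.prob_space_distr prob_space_rcp)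
  fix B assume B: "B \<in> sets S"
  show "AE \<omega> in restr_to_subalg M F.
      measure (distr (Q \<omega>) S X) B = cond_probability M F (X -` B \<inter> space M) \<omega>"
    using cond_probability_eq_rcp[OF measurable_sets[OF X B]] AE_space
    by eventually_elim
      (simp add: measure_distr space_restr_to_subalg measurable_rcp_iff space_rcp X B)
qed

text \<open>Almost sure uniqueness of conditional distributions: for each \<open>B\<close> two
  versions agree almost surely with the same conditional probability, and a countable generator
  turns this into equality of measures off one null set.\<close>

lemma cond_distribution_eq_distr_rcp:
  fixes X :: "'a \<Rightarrow> 'b::second_countable_topology"
  assumes X: "X \<in> borel_measurable M"
  shows "AE \<omega> in restr_to_subalg M F. cond_distribution M F borel X \<omega> = distr (Q \<omega>) borel X"
proof -
  obtain G :: "'b set set" where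
    G: "countable G" "Int_stable G" "UNIV \<in> G" "sets borel = sigma_sets UNIV G"
    by (rule borel_countable_Int_stable_generator)
  define \<kappa> where "\<kappa> = cond_distribution M F borel X"
  \<comment> \<open>The choice by \<open>SOME\<close> yields a genuine version because the image of
    \<open>Q\<close> is a witness.\<close>
  have \<kappa>: "is_cond_distribution M F borel X \<kappa>"
    unfolding \<kappa>_def cond_distribution_def
    using is_cond_distribution_distr_rcp[OF X] by (rule someI[where P = "is_cond_distribution M F borel X"])
  have ker: "prob_space (\<nu> \<omega>) \<and> sets (\<nu> \<omega>) = sigma_sets UNIV G"
    if "is_cond_distribution M F borel X \<nu>" "\<omega> \<in> space (restr_to_subalg M F)" for \<nu> \<omega>
    using that measurable_space[of \<nu> F "prob_algebra borel" \<omega>]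
    by (auto simp: is_cond_distribution_def space_prob_algebra space_subalg space_restr_to_subalg G(4))
  have "AE \<omega> in restr_to_subalg M F. \<kappa> \<omega> = distr (Q \<omega>) borel X"
  proof (rule AE_prob_measures_eqI[OF G(1-3)])
    fix B assume "B \<in> G"
    then have B: "B \<in> sets borel" by (simp add: G(4))
    have "AE \<omega> in restr_to_subalg M F.
        measure (\<kappa> \<omega>) B = cond_probability M F (X -` B \<inter> space M) \<omega>"
      "AE \<omega> in restr_to_subalg M F.
        measure (distr (Q \<omega>) borel X) B = cond_probability M F (X -` B \<inter> space M) \<omega>"
      using \<kappa> is_cond_distribution_distr_rcp[OF X] B by (auto simp: is_cond_distribution_def)
    then show "AE \<omega> in restr_to_subalg M F. measure (\<kappa> \<omega>) B = measure (distr (Q \<omega>) borel X) B"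
      by eventually_elim simp
  qed (use ker[OF \<kappa>] ker[OF is_cond_distribution_distr_rcp[OF X]] in auto)
  then show ?thesis by (simp add: \<kappa>_def)
qed

section \<open>Conditional independence against independence under \<open>Q \<omega>\<close>\<close>

text \<open>The null set in conditional independence depends on the events. Countably many tests,
  given by finite index sets and generator sets, decide independence under
  \<open>Q \<omega>\<close>, so one null set serves for all.\<close>

lemma cond_indep_vars_imp_indep_rcp:
  fixes X :: "'i \<Rightarrow> 'a \<Rightarrow> 'b::second_countable_topology"
  assumes "countable I" and ind: "cond_indep_vars M F borel X I"
  shows "AE \<omega> in restr_to_subalg M F. prob_space.indep_vars (Q \<omega>) (\<lambda>_. borel) X I"
proof -
  let ?R = "restr_to_subalg M F"
  obtain G :: "'b set set" where
    G: "countable G" "Int_stable G" "UNIV \<in> G" "sets borel = sigma_sets UNIV G"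
    by (rule borel_countable_Int_stable_generator)
  have X: "X i \<in> borel_measurable M" if "i \<in> I" for i
    using ind that by (simp add: cond_indep_vars_def)
  \<comment> \<open>All tests in one index set. It is countable because each \<open>J\<close> is
    finite and \<open>G\<close> is countable.\<close>
  define \<J> where "\<J> = (SIGMA J:{J. finite J \<and> J \<subseteq> I \<and> 2 \<le> card J}. J \<rightarrow>\<^sub>E G)"
  have "countable {J. finite J \<and> J \<subseteq> I \<and> 2 \<le> card J}"
    by (rule countable_subset[OF _ countable_Collect_finite_subset[OF \<open>countable I\<close>]]) auto
  then have "countable \<J>"
    unfolding \<J>_def using G(1) by (intro countable_SIGMA countable_PiE) auto
  have "AE \<omega> in ?R. \<forall>(J, A)\<in>\<J>.
      measure (Q \<omega>) (\<Inter>j\<in>J. X j -` A j \<inter> space M) = (\<Prod>j\<in>J. measure (Q \<omega>) (X j -` A j \<inter> space M))"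
    unfolding AE_ball_countable[OF \<open>countable \<J>\<close>]
  proof clarify
    fix J A assume "(J, A) \<in> \<J>"
    then have J: "finite J" "J \<subseteq> I" "2 \<le> card J" and "A \<in> J \<rightarrow>\<^sub>E G"
      by (auto simp: \<J>_def)
    from PiE_mem[OF this(4)] have A: "A j \<in> G" if "j \<in> J" for j
      using that by blast
    let ?E = "\<lambda>j. X j -` A j \<inter> space M"
    have A': "A j \<in> sets borel" if "j \<in> J" for j
      using A that by (auto simp: G(4))
    then have E: "?E j \<in> sets M" if "j \<in> J" for j
      using X J that by (intro measurable_sets[of _ M borel]) auto
    \<comment> \<open>An intersection over the empty index set would be \<open>UNIV\<close>, which
      need not be an event of \<open>M\<close>.\<close>
    have "J \<noteq> {}" using J by auto
    have "AE \<omega> in ?R. cond_probability M F (\<Inter>j\<in>J. ?E j) \<omega>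
        = (\<Prod>j\<in>J. cond_probability M F (?E j) \<omega>)"
    proof -
      have "\<forall>j\<in>J. ?E j \<in> sets (vimage_algebra (space M) (X j) borel)"
        using A' by (blast intro: in_vimage_algebra)
      with ind J show ?thesis
        unfolding cond_indep_vars_def by meson
    qed
    moreover have "AE \<omega> in ?R. cond_probability M F (\<Inter>j\<in>J. ?E j) \<omega> = measure (Q \<omega>) (\<Inter>j\<in>J. ?E j)"
      using E J \<open>J \<noteq> {}\<close> by (intro cond_probability_eq_rcp sets.finite_INT) auto
    moreover have "AE \<omega> in ?R. \<forall>j\<in>J. cond_probability M F (?E j) \<omega> = measure (Q \<omega>) (?E j)"
      using E J by (intro AE_finite_allI cond_probability_eq_rcp) auto
    ultimately show "AE \<omega> in ?R. measure (Q \<omega>) (\<Inter>j\<in>J. ?E j) = (\<Prod>j\<in>J. measure (Q \<omega>) (?E j))"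
      by eventually_elim simp
  qed
  then show ?thesis
    using AE_space
  proof eventually_elim
    case (elim \<omega>)
    then have \<omega>: "\<omega> \<in> space M" by (simp add: space_restr_to_subalg)
    interpret Q: prob_space "Q \<omega>" by (rule prob_space_rcp[OF \<omega>])
    show ?case
    proof (rule Q.indep_vars_generatorI[where G = G])
      fix J A assume "J \<subseteq> I" "finite J" "2 \<le> card J" "A \<in> J \<rightarrow>\<^sub>E G"
      then have "(J, A) \<in> \<J>" by (auto simp: \<J>_def)
      from bspec[OF elim(1) this]
      show "Q.prob (\<Inter>j\<in>J. X j -` A j \<inter> space (Q \<omega>)) = (\<Prod>j\<in>J. Q.prob (X j -` A j \<inter> space (Q \<omega>)))"
        by (simp add: space_rcp[OF \<omega>])
    qed (use X G in \<open>auto simp: measurable_rcp_iff[OF \<omega>]\<close>)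
  qed
qed

text \<open>Here the events are fixed before the null set. It is enough to discard the exceptional
  sets for the intersection, for the finitely many factors and for the independence under
  \<open>Q \<omega>\<close>.\<close>

lemma indep_rcp_imp_cond_indep_vars:
  assumes X: "\<And>i. i \<in> I \<Longrightarrow> X i \<in> M \<rightarrow>\<^sub>M S"
    and ind: "AE \<omega> in restr_to_subalg M F. prob_space.indep_vars (Q \<omega>) (\<lambda>_. S) X I"
  shows "cond_indep_vars M F S X I"
  unfolding cond_indep_vars_def
proof (intro conjI ballI allI impI)
  fix J E assume J: "J \<subseteq> I" "finite J" "2 \<le> card J"
    and E: "\<forall>j\<in>J. E j \<in> sets (vimage_algebra (space M) (X j) S)"
  let ?R = "restr_to_subalg M F"
  \<comment> \<open>Every event of the sigma-algebra of \<open>X j\<close> is itself a preimage,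
    which is the form that the product rule for independent variables expects.\<close>
  have "\<forall>j\<in>J. \<exists>B\<in>sets S. E j = X j -` B \<inter> space M"
  proof
    fix j assume j: "j \<in> J"
    then have "X j \<in> space M \<rightarrow> space S"
      using measurable_space[OF X] J by auto
    then have "sets (vimage_algebra (space M) (X j) S) = {X j -` B \<inter> space M |B. B \<in> sets S}"
      by (rule sets_vimage_algebra2)
    then have "E j \<in> {X j -` B \<inter> space M |B. B \<in> sets S}"
      using E j by metis
    then show "\<exists>B\<in>sets S. E j = X j -` B \<inter> space M"
      by blast
  qed
  then obtain B where B: "\<And>j. j \<in> J \<Longrightarrow> B j \<in> sets S" "\<And>j. j \<in> J \<Longrightarrow> E j = X j -` B j \<inter> space M"
    by metis
  have E': "E j \<in> sets M" if "j \<in> J" for j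
    using measurable_sets[OF X B(1)] that B(2) J by auto
  have "J \<noteq> {}" using J by auto
  have "AE \<omega> in ?R. cond_probability M F (\<Inter>j\<in>J. E j) \<omega> = measure (Q \<omega>) (\<Inter>j\<in>J. E j)"
    using E' J \<open>J \<noteq> {}\<close> by (intro cond_probability_eq_rcp sets.finite_INT) auto
  moreover have "AE \<omega> in ?R. \<forall>j\<in>J. cond_probability M F (E j) \<omega> = measure (Q \<omega>) (E j)"
    using E' J by (intro AE_finite_allI cond_probability_eq_rcp) auto
  ultimately show "AE \<omega> in ?R. cond_probability M F (\<Inter>j\<in>J. E j) \<omega>
      = (\<Prod>j\<in>J. cond_probability M F (E j) \<omega>)"
    using ind AE_space
  proof eventually_elim
    case (elim \<omega>)
    then have \<omega>: "\<omega> \<in> space M" by (simp add: space_restr_to_subalg)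
    interpret Q: prob_space "Q \<omega>" by (rule prob_space_rcp[OF \<omega>])
    have "measure (Q \<omega>) (\<Inter>j\<in>J. E j) = (\<Prod>j\<in>J. measure (Q \<omega>) (E j))"
      using Q.indep_varsD[OF elim(3) \<open>J \<noteq> {}\<close> J(2,1), of B] B by (simp add: space_rcp[OF \<omega>])
    with elim show ?case by simp
  qed
qed (rule X)

section \<open>Common distributions and the general equivalence\<close>

text \<open>Disintegrating along \<open>Q\<close> turns the mass of the part of \<open>A\<close>
  where \<open>X i\<close> lies in \<open>B\<close> into the integral of \<open>K \<omega> B\<close>
  over \<open>A\<close>, and this expression no longer involves \<open>i\<close>.\<close>

lemma cond_ident_distr_of_rcp:
  assumes X: "\<And>i. i \<in> I \<Longrightarrow> X i \<in> M \<rightarrow>\<^sub>M S"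
    and distr: "\<And>i. i \<in> I \<Longrightarrow> AE \<omega> in restr_to_subalg M F. distr (Q \<omega>) S (X i) = K \<omega>"
  shows "cond_ident_distr M F S X I"
proof -
  have eq: "emeasure M (A \<inter> (X i -` B)) = (\<integral>\<^sup>+\<omega>\<in>A. emeasure (K \<omega>) B \<partial>restr_to_subalg M F)"
    if i: "i \<in> I" and A: "A \<in> sets F" and B: "B \<in> sets S" for i A B
  proof -
    \<comment> \<open>\<open>cond_ident_distr\<close> takes preimages in the whole type; inside
      \<open>A\<close>, a subset of \<open>space M\<close>, this makes no difference.\<close>
    have "A \<inter> (X i -` B) = (X i -` B \<inter> space M) \<inter> A"
      using sets.sets_into_space[OF A] by (auto simp: space_subalg)
    then have "emeasure M (A \<inter> (X i -` B))
        = (\<integral>\<^sup>+\<omega>\<in>A. emeasure (Q \<omega>) (X i -` B \<inter> space M) \<partial>restr_to_subalg M F)"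
      using emeasure_Int_eq_rcp[OF A measurable_sets[OF X[OF i] B]] by simp
    also have "\<dots> = (\<integral>\<^sup>+\<omega>\<in>A. emeasure (K \<omega>) B \<partial>restr_to_subalg M F)"
    proof (rule nn_integral_cong_AE)
      show "AE \<omega> in restr_to_subalg M F.
          emeasure (Q \<omega>) (X i -` B \<inter> space M) * indicator A \<omega> = emeasure (K \<omega>) B * indicator A \<omega>"
        using distr[OF i] AE_space
      proof eventually_elim
        case (elim \<omega>)
        then have \<omega>: "\<omega> \<in> space M" by (simp add: space_restr_to_subalg)
        show ?case
          unfolding elim(1)[symmetric] using X[OF i] B
          by (simp add: emeasure_distr measurable_rcp_iff[OF \<omega>] space_rcp[OF \<omega>])
      qed
    qed
    finally show ?thesis .
  qed
  then show ?thesis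
    using X by (auto simp: cond_ident_distr_def)
qed

text \<open>The independence parts correspond by the two lemmas above. For the distributions,
  \<open>cond_distribution\<close> may be replaced almost surely by the image of
  \<open>Q \<omega>\<close>; countability of \<open>I\<close> then moves the quantifier over indices
  inside the almost sure statement.\<close>

theorem cond_iid_iff_rcp:
  fixes X :: "'i \<Rightarrow> 'a \<Rightarrow> 'b::second_countable_topology"
  assumes I: "countable I"
  shows "(cond_iid M F borel X I \<and>
          (\<forall>i\<in>I. AE \<omega> in restr_to_subalg M F. K \<omega> = cond_distribution M F borel (X i) \<omega>))
     \<longleftrightarrow> (AE \<omega> in restr_to_subalg M F.
            prob_space.indep_vars (Q \<omega>) (\<lambda>_. borel) X I \<and>
            (\<forall>i\<in>I. distr (Q \<omega>) borel (X i) = K \<omega>))"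
    (is "?C \<and> ?D \<longleftrightarrow> ?R")
proof -
  have distr: "(AE \<omega> in restr_to_subalg M F. K \<omega> = cond_distribution M F borel (X i) \<omega>)
      \<longleftrightarrow> (AE \<omega> in restr_to_subalg M F. distr (Q \<omega>) borel (X i) = K \<omega>)"
    if "X i \<in> borel_measurable M" for i
  proof (rule eventually_subst)
    show "AE \<omega> in restr_to_subalg M F. (K \<omega> = cond_distribution M F borel (X i) \<omega>)
        = (distr (Q \<omega>) borel (X i) = K \<omega>)"
      using cond_distribution_eq_distr_rcp[OF that]
    proof eventually_elim
      case (elim \<omega>)
      show ?case unfolding elim by (rule eq_commute)
    qed
  qed
  show ?thesis
  proof
    assume "?C \<and> ?D"
    then have ind: "cond_indep_vars M F borel X I" and ?D
      by (auto simp: cond_iid_def)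
    moreover have "X i \<in> borel_measurable M" if "i \<in> I" for i
      using ind that by (simp add: cond_indep_vars_def)
    ultimately have "\<forall>i\<in>I. AE \<omega> in restr_to_subalg M F. distr (Q \<omega>) borel (X i) = K \<omega>"
      using distr by blast
    with cond_indep_vars_imp_indep_rcp[OF I ind] show ?R
      by (simp add: AE_conj_iff AE_ball_countable[OF I])
  next
    assume R: ?R
    interpret R: prob_space "restr_to_subalg M F"
      by (rule prob_space_restr_to_subalg[OF subalgebra prob_space_axioms])
    \<comment> \<open>The left side contains the measurability of \<open>X i\<close> with respect to
      \<open>M\<close>, which must be extracted from an almost sure statement. Under a probability
      measure such a statement holds for at least one \<omega>, and \<open>Q \<omega>\<close> has
      the same measurable sets as \<open>M\<close>.\<close>
    obtain \<omega> where \<omega>: "\<omega> \<in> space M" "prob_space.indep_vars (Q \<omega>) (\<lambda>_. borel) X I"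
      using eventually_happens[OF eventually_conj[OF R AE_space]] R.not_empty
      by (auto simp: space_restr_to_subalg R.ae_filter_bot)
    then have X: "X i \<in> borel_measurable M" if "i \<in> I" for i
      using that
      by (auto simp: prob_space.indep_vars_def2[OF prob_space_rcp] measurable_rcp_iff)
    have d: "AE \<omega> in restr_to_subalg M F. distr (Q \<omega>) borel (X i) = K \<omega>" if "i \<in> I" for i
      using R by eventually_elim (use that in blast)
    have "AE \<omega> in restr_to_subalg M F. prob_space.indep_vars (Q \<omega>) (\<lambda>_. borel) X I"
      using R by eventually_elim blast
    with X have "cond_indep_vars M F borel X I"
      by (rule indep_rcp_imp_cond_indep_vars)
    moreover have "cond_ident_distr M F borel X I"
      using X d by (rule cond_ident_distr_of_rcp)
    ultimately have ?C
      by (simp add: cond_iid_def)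
    with X d distr show "?C \<and> ?D" by blast
  qed
qed

end

section \<open>Interarrival times of a counting process\<close>

theorem corollary3p9:
  fixes M F :: "'a measure"
    and N :: "real \<Rightarrow> 'a \<Rightarrow> enat"
    and Q :: "'a \<Rightarrow> 'a measure"
    and K :: "'a \<Rightarrow> real measure"
  assumes "prob_space M"
    and "counting_process M N"
    and "subalgebra M F"
    and "subfield_rcp M F Q"
    and "K \<in> F \<rightarrow>\<^sub>M prob_algebra borel"
  shows "(cond_iid M F borel (interarrival N) {1..} \<and>
          (\<forall>n\<ge>1. AE \<omega> in restr_to_subalg M F.
             K \<omega> = cond_distribution M F borel (interarrival N n) \<omega>))
     \<longleftrightarrow>
         (AE \<omega> in restr_to_subalg M F.
            prob_space.indep_vars (Q \<omega>) (\<lambda>_. borel) (interarrival N) {1..} \<and>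
            (\<forall>n\<ge>1. distr (Q \<omega>) borel (interarrival N n) = K \<omega>))"
proof -
  interpret subfield_rcp_space M F Q
    using assms(1,3,4) by (simp add: subfield_rcp_space_def subfield_rcp_space_axioms_def)
  show ?thesis
    \<comment> \<open>The index set \<open>{1..}\<close> is a countable set of natural numbers, and
      membership in it unfolds to the condition \<open>n \<ge> 1\<close> of the statement.\<close>
    using cond_iid_iff_rcp[of "{1..}" "interarrival N" K] by (simp add: Ball_def)
qed

end
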